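(* Let $K$ be a field, let $J\subseteq I$ be monomial ideals in $R=K[x_1,\ldots,x_n]$, and let $\mathfrak{p}\in V^*(I)$. If $J$ is a demotion of $I$, then $J(\mathfrak{p})$ is a demotion of $I(\mathfrak{p})$.
   Context: For ideals $J\subseteq I$ in a commutative Noetherian ring $R$, $J$ is a demotion of $I$ if $I^rJ^s=I^{r+s}\cap J^s$ for all integers $r,s\geq 0$ (with $I^0=J^0=R$). $V^*(I)$ denotes the set of monomial prime ideals (prime ideals generated by subsets of the variables) containing $I$. For a monomial prime ideal $\mathfrak{p}=(x_{i_1},\ldots,x_{i_r})$, the monomial localization $I(\mathfrak{p})$ of a monomial ideal $I$ is the ideal of the polynomial ring $R(\mathfrak{p})=K[x_{i_1},\ldots,x_{i_r}]$ obtained from $I$ as its image under the $K$-algebra homomorphism $R\to R(\mathfrak{p})$ with $x_j\mapsto 1$ for all $x_j\notin\{x_{i_1},\ldots,x_{i_r}\}$ (and fixing $x_{i_1},\dots,x_{i_r}$). *)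

theory Defs
  imports "HOL-Library.Poly_Mapping" "HOL-Algebra.Ideal_Product"
begin

section \<open>Demotions of ideals\<close>

text \<open>In the monoid \<^term>\<open>ideals_set R\<close> the product is the product of ideals and the unit is the
  whole ring, so that \<open>I\<close> to the power 0 is \<open>carrier R\<close>. The ring is meant to be commutative and
  Noetherian; polynomial rings in finitely many variables over a field always are.\<close>

abbreviation ideal_pow :: "('a, 'b) ring_scheme \<Rightarrow> 'a set \<Rightarrow> nat \<Rightarrow> 'a set" where
  "ideal_pow R I r \<equiv> I [^]\<^bsub>ideals_set R\<^esub> r"

definition demotion :: "('a, 'b) ring_scheme \<Rightarrow> 'a set \<Rightarrow> 'a set \<Rightarrow> bool" where
  "demotion R J I \<longleftrightarrow> ideal I R \<and> ideal J R \<and> J \<subseteq> I \<and>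
     (\<forall>r s. ideal_prod R (ideal_pow R I r) (ideal_pow R J s)
            = ideal_pow R I (r + s) \<inter> ideal_pow R J s)"


section \<open>Polynomial rings\<close>

text \<open>A monomial is its exponent vector \<open>'x \<Rightarrow>\<^sub>0 nat\<close>, a polynomial a finitely supported
  function from monomials to coefficients. All polynomial rings \<open>K[X]\<close>, for varying sets \<open>X\<close>
  of variables, live in the same type and differ only in their carriers.\<close>

type_synonym ('x, 'k) mpoly = "('x \<Rightarrow>\<^sub>0 nat) \<Rightarrow>\<^sub>0 'k"

definition poly_ring :: "'x set \<Rightarrow> ('x, 'k::field) mpoly ring" where
  "poly_ring X =
     \<lparr>carrier = {f. \<forall>m \<in> Poly_Mapping.keys f. Poly_Mapping.keys m \<subseteq> X},
      mult = (*), one = 1, zero = 0, add = (+)\<rparr>"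

definition Const :: "'k::field \<Rightarrow> ('x, 'k) mpoly" where
  "Const c = Poly_Mapping.single 0 c"

definition Monom :: "('x \<Rightarrow>\<^sub>0 nat) \<Rightarrow> ('x, 'k::field) mpoly" where
  "Monom m = Poly_Mapping.single m 1"

definition Var :: "'x \<Rightarrow> ('x, 'k::field) mpoly" where
  "Var i = Monom (Poly_Mapping.single i 1)"

text \<open>Evaluation of a polynomial at \<open>\<sigma>\<close>: the \<open>K\<close>-algebra homomorphism sending each variable
  \<open>i\<close> to \<open>\<sigma> i\<close> (see \<open>subst_add\<close>, \<open>subst_mult\<close>, \<open>subst_Const\<close>, \<open>subst_Var\<close> below).\<close>

definition subst_monom :: "('x \<Rightarrow> ('x, 'k::field) mpoly) \<Rightarrow> ('x \<Rightarrow>\<^sub>0 nat) \<Rightarrow> ('x, 'k) mpoly" where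
  "subst_monom \<sigma> m = (\<Prod>i\<in>Poly_Mapping.keys m. \<sigma> i ^ Poly_Mapping.lookup m i)"

definition subst :: "('x \<Rightarrow> ('x, 'k::field) mpoly) \<Rightarrow> ('x, 'k) mpoly \<Rightarrow> ('x, 'k) mpoly" where
  "subst \<sigma> f = (\<Sum>m\<in>Poly_Mapping.keys f. Const (Poly_Mapping.lookup f m) * subst_monom \<sigma> m)"


section \<open>Monomial ideals and monomial localization\<close>

definition monomial_ideal :: "'x set \<Rightarrow> ('x, 'k::field) mpoly set \<Rightarrow> bool" where
  "monomial_ideal X I \<longleftrightarrow>
     (\<exists>M \<subseteq> {m. Poly_Mapping.keys m \<subseteq> X}. I = Idl\<^bsub>poly_ring X\<^esub> (Monom ` M))"

definition monomial_prime :: "'x set \<Rightarrow> ('x, 'k::field) mpoly set \<Rightarrow> bool" where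
  "monomial_prime X P \<longleftrightarrow>
     primeideal P (poly_ring X) \<and> (\<exists>S \<subseteq> X. P = Idl\<^bsub>poly_ring X\<^esub> (Var ` S))"

definition Vstar :: "'x set \<Rightarrow> ('x, 'k::field) mpoly set \<Rightarrow> ('x, 'k) mpoly set set" where
  "Vstar X I = {P. monomial_prime X P \<and> I \<subseteq> P}"

text \<open>The variables generating a monomial prime ideal are exactly the variables it contains.\<close>

definition vars_in :: "('x, 'k::field) mpoly set \<Rightarrow> 'x set" where
  "vars_in P = {i. Var i \<in> P}"

definition loc_ring :: "('x, 'k::field) mpoly set \<Rightarrow> ('x, 'k) mpoly ring" where
  "loc_ring P = poly_ring (vars_in P)"

definition loc_hom :: "('x, 'k::field) mpoly set \<Rightarrow> ('x, 'k) mpoly \<Rightarrow> ('x, 'k) mpoly" where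
  "loc_hom P = subst (\<lambda>i. if i \<in> vars_in P then Var i else 1)"

definition monomial_loc :: "('x, 'k::field) mpoly set \<Rightarrow> ('x, 'k) mpoly set \<Rightarrow> ('x, 'k) mpoly set" where
  "monomial_loc P I = loc_hom P ` I"


section \<open>Basic facts\<close>

lemma poly_ring_simps [simp]:
  "mult (poly_ring X) = (*)" "one (poly_ring X) = 1"
  "zero (poly_ring X) = 0" "add (poly_ring X) = (+)"
  by (simp_all add: poly_ring_def)

lemma poly_ring_add_closed:
  assumes "f \<in> carrier (poly_ring X)" "g \<in> carrier (poly_ring X)"
  shows "f + g \<in> carrier (poly_ring X)"
  using assms Poly_Mapping.keys_add[of f g] unfolding poly_ring_def by auto

lemma poly_ring_mult_closed:
  assumes "f \<in> carrier (poly_ring X)" "g \<in> carrier (poly_ring X)"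
  shows "f * g \<in> carrier (poly_ring X)"
proof -
  have "Poly_Mapping.keys m \<subseteq> X" if m: "m \<in> Poly_Mapping.keys (f * g)" for m
  proof -
    obtain a b where "m = a + b" "a \<in> Poly_Mapping.keys f" "b \<in> Poly_Mapping.keys g"
      using m keys_mult[of f g] by blast
    moreover from this have "Poly_Mapping.keys a \<subseteq> X" "Poly_Mapping.keys b \<subseteq> X"
      using assms by (auto simp: poly_ring_def)
    ultimately show ?thesis
      using Poly_Mapping.keys_add[of a b] by blast
  qed
  then show ?thesis
    by (simp add: poly_ring_def)
qed

lemma poly_ring_carrier_zero_one:
  "0 \<in> carrier (poly_ring X)" "1 \<in> carrier (poly_ring X)"
  by (simp_all add: poly_ring_def)

lemma keys_uminus_mpoly: "Poly_Mapping.keys (- f) = Poly_Mapping.keys (f :: ('x, 'k::field) mpoly)"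
  by (auto simp: in_keys_iff)

lemma cring_poly_ring: "cring (poly_ring X :: ('x, 'k::field) mpoly ring)"
proof (rule cringI)
  show "abelian_group (poly_ring X :: ('x, 'k) mpoly ring)"
  proof (rule abelian_groupI)
    fix x :: "('x, 'k) mpoly" assume x: "x \<in> carrier (poly_ring X)"
    have "- x \<in> carrier (poly_ring X)"
      using x by (simp add: poly_ring_def keys_uminus_mpoly)
    then show "\<exists>y\<in>carrier (poly_ring X). y \<oplus>\<^bsub>poly_ring X\<^esub> x = \<zero>\<^bsub>poly_ring X\<^esub>"
      by (intro bexI[of _ "- x"]) simp_all
  qed (simp_all add: poly_ring_add_closed poly_ring_carrier_zero_one ac_simps)
  show "Group.comm_monoid (poly_ring X :: ('x, 'k) mpoly ring)"
    by (rule comm_monoidI)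
       (simp_all add: poly_ring_mult_closed poly_ring_carrier_zero_one ac_simps)
qed (simp add: distrib_right)

lemma subst_monom_superset:
  assumes "finite A" "Poly_Mapping.keys m \<subseteq> A"
  shows "subst_monom \<sigma> m = (\<Prod>i\<in>A. \<sigma> i ^ Poly_Mapping.lookup m i)"
  unfolding subst_monom_def
  by (rule prod.mono_neutral_left) (use assms in \<open>auto simp: in_keys_iff\<close>)

lemma subst_monom_add: "subst_monom \<sigma> (a + b) = subst_monom \<sigma> a * subst_monom \<sigma> b"
proof -
  let ?A = "Poly_Mapping.keys a \<union> Poly_Mapping.keys b"
  have "subst_monom \<sigma> (a + b) = (\<Prod>i\<in>?A. \<sigma> i ^ Poly_Mapping.lookup (a + b) i)"
    by (rule subst_monom_superset) (auto dest: subsetD[OF Poly_Mapping.keys_add])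
  also have "\<dots> = subst_monom \<sigma> a * subst_monom \<sigma> b"
    by (simp add: lookup_add power_add prod.distrib subst_monom_superset[of ?A])
  finally show ?thesis .
qed

lemma subst_superset:
  assumes "finite A" "Poly_Mapping.keys f \<subseteq> A"
  shows "subst \<sigma> f = (\<Sum>m\<in>A. Const (Poly_Mapping.lookup f m) * subst_monom \<sigma> m)"
  unfolding subst_def
  by (rule sum.mono_neutral_left) (use assms in \<open>auto simp: in_keys_iff Const_def\<close>)

lemma subst_add: "subst \<sigma> (f + g) = subst \<sigma> f + subst \<sigma> g"
proof -
  let ?A = "Poly_Mapping.keys f \<union> Poly_Mapping.keys g"
  have "subst \<sigma> (f + g)
      = (\<Sum>m\<in>?A. Const (Poly_Mapping.lookup (f + g) m) * subst_monom \<sigma> m)"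
    by (rule subst_superset) (auto dest: subsetD[OF Poly_Mapping.keys_add])
  also have "\<dots> = subst \<sigma> f + subst \<sigma> g"
    by (simp add: lookup_add Const_def single_add distrib_right sum.distrib subst_superset[of ?A])
  finally show ?thesis .
qed

lemma subst_single: "subst \<sigma> (Poly_Mapping.single m c) = Const c * subst_monom \<sigma> m"
  by (subst subst_superset[of "{m}"]) (auto simp: Const_def)

lemma subst_zero: "subst \<sigma> 0 = 0"
  by (simp add: subst_def)

lemma subst_sum: "subst \<sigma> (sum F A) = (\<Sum>a\<in>A. subst \<sigma> (F a))"
  by (induction A rule: infinite_finite_induct) (auto simp: subst_zero subst_add)

lemma mpoly_expand:
  "(\<Sum>m\<in>Poly_Mapping.keys f. Poly_Mapping.single m (Poly_Mapping.lookup f m)) = f"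
  by (rule poly_mapping_eqI)
     (auto simp: lookup_sum lookup_single when_def in_keys_iff)

lemma Const_mult: "Const (c * d) = Const c * Const d"
  by (simp add: Const_def mult_single)

lemma subst_mult: "subst \<sigma> (f * g) = subst \<sigma> f * subst \<sigma> g"
proof -
  have "subst \<sigma> (f * g) = subst \<sigma>
      ((\<Sum>m\<in>Poly_Mapping.keys f. Poly_Mapping.single m (Poly_Mapping.lookup f m)) *
       (\<Sum>m\<in>Poly_Mapping.keys g. Poly_Mapping.single m (Poly_Mapping.lookup g m)))"
    by (simp only: mpoly_expand)
  also have "\<dots> = (\<Sum>a\<in>Poly_Mapping.keys f. \<Sum>b\<in>Poly_Mapping.keys g.
      Const (Poly_Mapping.lookup f a) * subst_monom \<sigma> a *
      (Const (Poly_Mapping.lookup g b) * subst_monom \<sigma> b))"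
    by (simp add: sum_product subst_sum mult_single subst_single subst_monom_add Const_mult
        ac_simps)
  also have "\<dots> = subst \<sigma> f * subst \<sigma> g"
    by (simp add: subst_def sum_product)
  finally show ?thesis .
qed

lemma subst_Const: "subst \<sigma> (Const c) = Const c"
  by (simp add: Const_def[of c] subst_single subst_monom_def)

lemma subst_Var: "subst \<sigma> (Var i) = \<sigma> i"
  by (simp add: Var_def Monom_def subst_single subst_monom_def Const_def)

lemma subst_one: "subst \<sigma> 1 = 1"
  using subst_Const[of \<sigma> 1] by (simp add: Const_def)

lemma poly_ring_carrier_Const: "Const c \<in> carrier (poly_ring X)"
  by (simp add: poly_ring_def Const_def)

lemma poly_ring_carrier_Var: "Var i \<in> carrier (poly_ring X) \<longleftrightarrow> i \<in> X"
  by (simp add: poly_ring_def Var_def Monom_def)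

lemma loc_hom_carrier: "loc_hom P f \<in> carrier (loc_ring P)"
proof -
  have sum_closed: "sum F A \<in> carrier (poly_ring X)"
    if "\<And>a. a \<in> A \<Longrightarrow> F a \<in> carrier (poly_ring X)"
    for F :: "'c \<Rightarrow> ('a, 'b) mpoly" and A X
    using that by (induction A rule: infinite_finite_induct)
      (auto intro: poly_ring_add_closed poly_ring_carrier_zero_one)
  have power_closed: "x ^ k \<in> carrier (poly_ring X)"
    if "x \<in> carrier (poly_ring X)" for x :: "('a, 'b) mpoly" and k X
    using that by (induction k) (auto intro: poly_ring_mult_closed poly_ring_carrier_zero_one)
  have prod_closed: "prod F A \<in> carrier (poly_ring X)"
    if "\<And>a. a \<in> A \<Longrightarrow> F a \<in> carrier (poly_ring X)"
    for F :: "'c \<Rightarrow> ('a, 'b) mpoly" and A X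
    using that by (induction A rule: infinite_finite_induct)
      (auto intro: poly_ring_mult_closed poly_ring_carrier_zero_one)
  show ?thesis
    unfolding loc_hom_def loc_ring_def subst_def subst_monom_def
    by (intro sum_closed poly_ring_mult_closed poly_ring_carrier_Const prod_closed power_closed)
       (auto simp: poly_ring_carrier_Var poly_ring_carrier_zero_one)
qed

lemma loc_hom_ring_hom: "loc_hom P \<in> ring_hom (poly_ring X) (loc_ring P)"
  by (rule ring_hom_memI)
     (use loc_hom_carrier in
       \<open>auto simp: loc_hom_def loc_ring_def subst_add subst_mult subst_one\<close>)

lemma loc_hom_Const: "loc_hom P (Const c) = Const c"
  by (simp add: loc_hom_def subst_Const)

lemma loc_hom_Var: "loc_hom P (Var i) = (if i \<in> vars_in P then Var i else 1)"
  by (simp add: loc_hom_def subst_Var)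

end

theory Submission
  imports Defs "HOL-Algebra.RingHom"
begin

text \<open>
  Localization at \<open>\<pp>\<close> is the ring homomorphism \<open>h\<close> from \<open>K[X]\<close> to \<open>K[Y]\<close>, with \<open>Y \<subseteq> X\<close> the
  variables in \<open>\<pp>\<close>, that sets the other variables to 1. It fixes \<open>K[Y]\<close>, so it is surjective, and
  images under a surjective ring homomorphism respect ideals, their products and their powers
  (\<open>img_ideal_of_surj\<close>, \<open>img_ideal_prod\<close>, \<open>img_ideal_pow\<close>). The demotion identity is therefore
  carried over by \<open>h\<close> as soon as \<open>h\<close> respects the intersection on its right-hand side.

  A homomorphism need not respect intersections, and here the ideals being monomial matters: powers
  of monomial ideals contain every monomial that occurs in one of their elements
  (\<open>has_monomials_ideal_pow\<close>). If a monomial \<open>m\<close> of \<open>K[Y]\<close> is the image of a monomial \<open>a \<in> A\<close> and of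
  a monomial \<open>b \<in> B\<close>, then \<open>a\<close> and \<open>b\<close> differ from \<open>m\<close> only by variables that \<open>h\<close> sets to 1, and
  multiplying \<open>a\<close> by the part of \<open>b\<close> outside \<open>Y\<close> gives a common multiple of \<open>a\<close> and \<open>b\<close> that still
  maps to \<open>m\<close>. So \<open>m\<close> is the image of an element of \<open>A \<inter> B\<close> (\<open>monomial_loc_Int\<close>).
\<close>

section \<open>Images of ideals under surjective ring homomorphisms\<close>

lemma (in ring_hom_ring) img_ideal_of_surj:
  assumes surj: "h ` carrier R = carrier S" and I: "ideal I R"
  shows "ideal (h ` I) S"
proof (rule idealI)
  interpret I: ideal I R by (rule I)
  show "ring S" by (rule S.ring_axioms)
  show "subgroup (h ` I) (add_monoid S)"
    by (rule group_hom.subgroup_img_is_subgroup[OF a_group_hom I.a_subgroup])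
  fix a x assume a: "a \<in> h ` I" and x: "x \<in> carrier S"
  obtain b where b: "b \<in> I" "a = h b" using a by blast
  obtain y where y: "y \<in> carrier R" "x = h y" using x surj by blast
  show "x \<otimes>\<^bsub>S\<^esub> a \<in> h ` I"
    using b y I.I_l_closed[of b y] by (metis I.Icarr hom_mult imageI)
  show "a \<otimes>\<^bsub>S\<^esub> x \<in> h ` I"
    using b y I.I_r_closed[of b y] by (metis I.Icarr hom_mult imageI)
qed

lemma (in ring_hom_ring) img_ideal_prod:
  assumes A: "ideal A R" and B: "ideal B R"
  shows "h ` ideal_prod R A B = ideal_prod S (h ` A) (h ` B)"
proof
  interpret A: ideal A R by (rule A)
  interpret B: ideal B R by (rule B)
  have carr: "x \<in> carrier R" if "x \<in> ideal_prod R A B" for x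
    using R.ideal_prod_in_carrier[OF A B] that by blast
  have "h x \<in> ideal_prod S (h ` A) (h ` B)" if "x \<in> ideal_prod R A B" for x
    using that
  proof (induction x rule: ideal_prod.induct)
    case (prod i j)
    then show ?case
      by (simp add: A.Icarr B.Icarr ideal_prod.prod)
  next
    case (sum s t)
    then show ?case by (simp add: carr ideal_prod.sum)
  qed
  then show "h ` ideal_prod R A B \<subseteq> ideal_prod S (h ` A) (h ` B)" by blast
  have "y \<in> h ` ideal_prod R A B" if "y \<in> ideal_prod S (h ` A) (h ` B)" for y
    using that
  proof (induction y rule: ideal_prod.induct)
    case (prod i j)
    then obtain a b where ab: "a \<in> A" "b \<in> B" "i = h a" "j = h b" by blast
    then have "i \<otimes>\<^bsub>S\<^esub> j = h (a \<otimes> b)" by (simp add: A.Icarr B.Icarr)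
    then show ?case using ideal_prod.prod[OF ab(1,2)] by blast
  next
    case (sum s t)
    then obtain a b where ab: "a \<in> ideal_prod R A B" "b \<in> ideal_prod R A B" "s = h a" "t = h b"
      by blast
    then have "s \<oplus>\<^bsub>S\<^esub> t = h (a \<oplus> b)" by (simp add: carr)
    then show ?case using ideal_prod.sum[OF ab(1,2)] by blast
  qed
  then show "ideal_prod S (h ` A) (h ` B) \<subseteq> h ` ideal_prod R A B" by blast
qed

lemma ideal_pow_0: "ideal_pow R I 0 = carrier R"
  by (simp add: ideals_set_def)

lemma ideal_pow_Suc: "ideal_pow R I (Suc r) = ideal_prod R (ideal_pow R I r) I"
  by (simp add: ideals_set_def)

lemma (in ring) ideal_ideal_pow:
  assumes "ideal I R"
  shows "ideal (ideal_pow R I r) R"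
  by (induction r) (simp_all only: ideal_pow_0 ideal_pow_Suc oneideal ideal_prod_is_ideal assms)

lemma (in ring_hom_ring) img_ideal_pow:
  assumes "h ` carrier R = carrier S" "ideal I R"
  shows "h ` ideal_pow R I r = ideal_pow S (h ` I) r"
  by (induction r)
    (simp_all only: ideal_pow_0 ideal_pow_Suc img_ideal_prod R.ideal_ideal_pow assms)


section \<open>Sets of polynomials that contain the monomials of their elements\<close>

definition has_monomials :: "('x, 'k::field) mpoly set \<Rightarrow> bool" where
  "has_monomials A \<longleftrightarrow> (\<forall>f\<in>A. \<forall>m\<in>Poly_Mapping.keys f. Monom m \<in> A)"

lemma has_monomialsD: "has_monomials A \<Longrightarrow> f \<in> A \<Longrightarrow> m \<in> Poly_Mapping.keys f \<Longrightarrow> Monom m \<in> A"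
  by (auto simp: has_monomials_def)

lemma Monom_add: "Monom (a + b) = Monom a * Monom b"
  by (simp add: Monom_def mult_single)

lemma Monom_in_poly_ring: "Monom m \<in> carrier (poly_ring X) \<longleftrightarrow> Poly_Mapping.keys m \<subseteq> X"
  by (simp add: poly_ring_def Monom_def)

lemma has_monomials_poly_ring: "has_monomials (carrier (poly_ring X))"
  unfolding has_monomials_def Monom_in_poly_ring by (simp add: poly_ring_def)

lemma ring_poly_ring: "ring (poly_ring X :: ('x, 'k::field) mpoly ring)"
  by (rule cring.axioms(1)[OF cring_poly_ring])

lemma a_inv_poly_ring:
  fixes f :: "('x, 'k::field) mpoly"
  assumes "f \<in> carrier (poly_ring X)"
  shows "\<ominus>\<^bsub>poly_ring X\<^esub> f = - f"
proof -
  interpret ring "poly_ring X :: ('x, 'k) mpoly ring" by (rule ring_poly_ring)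
  have "- f \<in> carrier (poly_ring X)"
    using assms by (simp add: poly_ring_def keys_uminus_mpoly)
  then show ?thesis
    using minus_equality[of "- f" f] assms by simp
qed

text \<open>Those \<open>f\<close> all of whose monomials lie in the ideal again form an ideal; it contains the
  generators of the monomial ideal, hence everything.\<close>

lemma has_monomials_monomial_ideal:
  fixes I :: "('x, 'k::field) mpoly set"
  assumes "monomial_ideal X I"
  shows "has_monomials I"
proof -
  interpret R: ring "poly_ring X :: ('x, 'k) mpoly ring" by (rule ring_poly_ring)
  obtain M where M: "M \<subseteq> {m. Poly_Mapping.keys m \<subseteq> X}" and I: "I = Idl\<^bsub>poly_ring X\<^esub> (Monom ` M)"
    using assms by (auto simp: monomial_ideal_def)
  have gens: "(Monom ` M :: ('x, 'k) mpoly set) \<subseteq> carrier (poly_ring X)"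
    using M by (auto simp: Monom_in_poly_ring)
  interpret I: ideal I "poly_ring X"
    unfolding I by (rule R.genideal_ideal[OF gens])
  define D where "D = {f :: ('x, 'k) mpoly. f \<in> carrier (poly_ring X) \<and> (\<forall>m\<in>Poly_Mapping.keys f. Monom m \<in> I)}"
  have mult: "x * f \<in> D" if x: "x \<in> carrier (poly_ring X)" and f: "f \<in> D" for x f
  proof -
    have "Monom m \<in> I" if m: "m \<in> Poly_Mapping.keys (x * f)" for m
    proof -
      obtain a b where ab: "m = a + b" "a \<in> Poly_Mapping.keys x" "b \<in> Poly_Mapping.keys f"
        using m keys_mult[of x f] by blast
      have "(Monom a :: ('x, 'k) mpoly) \<in> carrier (poly_ring X)"
        using has_monomialsD[OF has_monomials_poly_ring x ab(2)] .
      moreover have "Monom b \<in> I" using f ab(3) by (simp add: D_def)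
      ultimately show ?thesis
        using I.I_l_closed[of "Monom b" "Monom a"] by (simp add: ab(1) Monom_add)
    qed
    then show ?thesis
      using x f by (simp add: D_def poly_ring_mult_closed)
  qed
  have "ideal D (poly_ring X)"
  proof (rule idealI)
    show "ring (poly_ring X :: ('x, 'k) mpoly ring)" by (rule ring_poly_ring)
    show "subgroup D (add_monoid (poly_ring X))"
    proof (rule R.add.subgroupI)
      show "D \<noteq> {}" using poly_ring_carrier_zero_one(1) by (force simp: D_def)
      show "\<ominus>\<^bsub>poly_ring X\<^esub> f \<in> D" if "f \<in> D" for f
        using that by (simp add: D_def a_inv_poly_ring keys_uminus_mpoly)
          (simp add: poly_ring_def keys_uminus_mpoly)
      show "f \<oplus>\<^bsub>poly_ring X\<^esub> g \<in> D" if "f \<in> D" "g \<in> D" for f g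
        using that Poly_Mapping.keys_add[of f g] by (auto simp: D_def poly_ring_add_closed)
    qed (auto simp: D_def)
    show "x \<otimes>\<^bsub>poly_ring X\<^esub> a \<in> D" "a \<otimes>\<^bsub>poly_ring X\<^esub> x \<in> D"
      if "a \<in> D" "x \<in> carrier (poly_ring X)" for a x
      using mult[OF that(2,1)] by (simp_all add: mult.commute)
  qed
  moreover have "Monom ` M \<subseteq> D"
    using gens R.genideal_self[OF gens] unfolding I[symmetric]
    by (auto simp: D_def Monom_def image_subset_iff)
  ultimately have "I \<subseteq> D"
    unfolding I by (rule R.genideal_minimal)
  then show ?thesis by (auto simp: has_monomials_def D_def)
qed

lemma has_monomials_ideal_prod:
  assumes A: "has_monomials A" and B: "has_monomials B"
  shows "has_monomials (ideal_prod (poly_ring X) A B)"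
proof -
  have "\<forall>m\<in>Poly_Mapping.keys f. Monom m \<in> ideal_prod (poly_ring X) A B"
    if "f \<in> ideal_prod (poly_ring X) A B" for f
    using that
  proof (induction f rule: ideal_prod.induct)
    case (prod f g)
    show ?case
    proof
      fix m assume "m \<in> Poly_Mapping.keys (f \<otimes>\<^bsub>poly_ring X\<^esub> g)"
      then obtain a b where ab: "m = a + b" "a \<in> Poly_Mapping.keys f" "b \<in> Poly_Mapping.keys g"
        using keys_mult[of f g] by auto
      show "Monom m \<in> ideal_prod (poly_ring X) A B"
        using ideal_prod.prod[OF has_monomialsD[OF A prod(1) ab(2)] has_monomialsD[OF B prod(2) ab(3)],
            of "poly_ring X"]
        by (simp add: ab(1) Monom_add)
    qed
  next
    case (sum f g)
    then show ?case using Poly_Mapping.keys_add[of f g] by auto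
  qed
  then show ?thesis by (simp add: has_monomials_def)
qed

lemma has_monomials_ideal_pow:
  assumes "has_monomials I"
  shows "has_monomials (ideal_pow (poly_ring X) I r)"
  by (induction r)
    (simp_all only: ideal_pow_0 ideal_pow_Suc has_monomials_poly_ring has_monomials_ideal_prod assms)


section \<open>Setting variables to one\<close>

text \<open>The monomial obtained by setting to 1 the variables outside \<open>Y\<close>.\<close>

definition restrict_monom :: "'x set \<Rightarrow> ('x \<Rightarrow>\<^sub>0 nat) \<Rightarrow> ('x \<Rightarrow>\<^sub>0 nat)" where
  "restrict_monom Y m = Poly_Mapping.mapp (\<lambda>i e. if i \<in> Y then e else 0) m"

lemma lookup_restrict_monom:
  "Poly_Mapping.lookup (restrict_monom Y m) i = (if i \<in> Y then Poly_Mapping.lookup m i else 0)"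
  by (simp add: restrict_monom_def lookup_mapp when_def in_keys_iff)

lemma restrict_monom_add: "restrict_monom Y (a + b) = restrict_monom Y a + restrict_monom Y b"
  by (rule poly_mapping_eqI) (simp add: lookup_restrict_monom lookup_add)

lemma restrict_monom_restrict:
  "restrict_monom Y (restrict_monom Z m) = restrict_monom (Y \<inter> Z) m"
  by (rule poly_mapping_eqI) (simp add: lookup_restrict_monom)

lemma restrict_monom_empty [simp]: "restrict_monom {} m = 0"
  by (rule poly_mapping_eqI) (simp add: lookup_restrict_monom)

lemma restrict_monom_split: "restrict_monom Y m + restrict_monom (- Y) m = m"
  by (rule poly_mapping_eqI) (simp add: lookup_restrict_monom lookup_add)

lemma restrict_monom_id: "Poly_Mapping.keys m \<subseteq> Y \<Longrightarrow> restrict_monom Y m = m"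
  by (rule poly_mapping_eqI) (auto simp: lookup_restrict_monom in_keys_iff)

lemma keys_restrict_monom: "Poly_Mapping.keys (restrict_monom Y m) = Poly_Mapping.keys m \<inter> Y"
  by (auto simp: in_keys_iff lookup_restrict_monom split: if_splits)

lemma Var_power: "(Var i :: ('x, 'k::field) mpoly) ^ e = Monom (Poly_Mapping.single i e)"
proof (induction e)
  case 0
  show ?case by (simp add: Monom_def)
next
  case (Suc e)
  have "Poly_Mapping.single i (Suc e) = Poly_Mapping.single i 1 + Poly_Mapping.single i e"
    by (simp flip: single_add)
  then have "(Monom (Poly_Mapping.single i (Suc e)) :: ('x, 'k) mpoly) = Var i * Monom (Poly_Mapping.single i e)"
    by (simp only: Var_def Monom_add)
  then show ?case by (simp add: Suc.IH)
qed

lemma prod_Monom: "(\<Prod>i\<in>A. Monom (a i)) = Monom (\<Sum>i\<in>A. a i)"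
  by (induction A rule: infinite_finite_induct) (simp_all add: Monom_add, simp_all add: Monom_def)

lemma subst_monom_restrict:
  "subst_monom (\<lambda>i. if i \<in> Y then Var i else 1) m = Monom (restrict_monom Y m)"
proof -
  let ?e = "\<lambda>i. if i \<in> Y then Poly_Mapping.lookup m i else 0"
  have "subst_monom (\<lambda>i. if i \<in> Y then Var i else 1) m
      = (\<Prod>i\<in>Poly_Mapping.keys m. Monom (Poly_Mapping.single i (?e i)))"
    unfolding subst_monom_def by (rule prod.cong) (auto simp: Var_power, simp add: Monom_def)
  also have "\<dots> = Monom (\<Sum>i\<in>Poly_Mapping.keys m. Poly_Mapping.single i (?e i))"
    by (rule prod_Monom)
  also have "(\<Sum>i\<in>Poly_Mapping.keys m. Poly_Mapping.single i (?e i)) = restrict_monom Y m"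
    by (rule poly_mapping_eqI)
      (auto simp: lookup_sum lookup_single lookup_restrict_monom when_def in_keys_iff)
  finally show ?thesis .
qed

lemma loc_hom_single:
  "loc_hom P (Poly_Mapping.single m c) = Poly_Mapping.single (restrict_monom (vars_in P) m) c"
  by (simp add: loc_hom_def subst_single subst_monom_restrict Const_def Monom_def mult_single)

lemma loc_hom_eq_sum:
  "loc_hom P f = (\<Sum>m\<in>Poly_Mapping.keys f.
     Poly_Mapping.single (restrict_monom (vars_in P) m) (Poly_Mapping.lookup f m))"
  by (simp add: loc_hom_def subst_def subst_monom_restrict Const_def Monom_def mult_single)

lemma loc_hom_fixes:
  assumes "f \<in> carrier (loc_ring P)"
  shows "loc_hom P f = f"
proof -
  have "loc_hom P f = (\<Sum>m\<in>Poly_Mapping.keys f. Poly_Mapping.single m (Poly_Mapping.lookup f m))"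
    unfolding loc_hom_eq_sum
    by (rule sum.cong) (use assms in \<open>auto simp: loc_ring_def poly_ring_def restrict_monom_id\<close>)
  then show ?thesis by (simp add: mpoly_expand)
qed

lemma keys_loc_hom: "Poly_Mapping.keys (loc_hom P f) \<subseteq> restrict_monom (vars_in P) ` Poly_Mapping.keys f"
  unfolding loc_hom_eq_sum
  by (rule order_trans[OF keys_sum]) (auto split: if_splits)

lemma loc_hom_image_carrier:
  assumes "vars_in P \<subseteq> X"
  shows "loc_hom P ` carrier (poly_ring X) = carrier (loc_ring P)"
proof
  show "loc_hom P ` carrier (poly_ring X) \<subseteq> carrier (loc_ring P)"
    using loc_hom_carrier by blast
  show "carrier (loc_ring P) \<subseteq> loc_hom P ` carrier (poly_ring X)"
  proof
    fix f assume f: "f \<in> carrier (loc_ring P)"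
    then have "f \<in> carrier (poly_ring X)"
      using assms by (auto simp: loc_ring_def poly_ring_def)
    then show "f \<in> loc_hom P ` carrier (poly_ring X)"
      using loc_hom_fixes[OF f] by (metis imageI)
  qed
qed

section \<open>Localization and intersections\<close>

text \<open>The monomial \<open>a\<close> times the part of \<open>b\<close> outside \<open>Y\<close> has the same restriction as \<open>a\<close>; as \<open>a\<close> and
  \<open>b\<close> agree on \<open>Y\<close>, it is also \<open>b\<close> times the part of \<open>a\<close> outside \<open>Y\<close>.\<close>

lemma common_monomial_lift:
  fixes A B :: "('x, 'k::field) mpoly set"
  assumes A: "ideal A (poly_ring X)" and B: "ideal B (poly_ring X)"
    and a: "Monom a \<in> A" and b: "Monom b \<in> B"
    and eq: "restrict_monom Y a = restrict_monom Y b"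
  obtains w where "(Monom w :: ('x, 'k) mpoly) \<in> A \<inter> B" "restrict_monom Y w = restrict_monom Y a"
proof
  interpret A: ideal A "poly_ring X" by (rule A)
  interpret B: ideal B "poly_ring X" by (rule B)
  let ?w = "restrict_monom (- Y) b + a"
  have w: "?w = restrict_monom (- Y) a + b"
    using restrict_monom_split[of Y a] restrict_monom_split[of Y b] eq by (metis add.left_commute add.commute)
  have "Poly_Mapping.keys a \<subseteq> X" "Poly_Mapping.keys b \<subseteq> X"
    using A.Icarr[OF a] B.Icarr[OF b] by (simp_all add: Monom_in_poly_ring)
  then have out: "(Monom (restrict_monom (- Y) a) :: ('x, 'k) mpoly) \<in> carrier (poly_ring X)"
    "(Monom (restrict_monom (- Y) b) :: ('x, 'k) mpoly) \<in> carrier (poly_ring X)"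
    by (auto simp: Monom_in_poly_ring keys_restrict_monom)
  have "Monom ?w \<in> A"
    using A.I_l_closed[OF a out(2)] by (simp add: Monom_add)
  moreover have "Monom ?w \<in> B"
    unfolding w using B.I_l_closed[OF b out(1)] by (simp add: Monom_add)
  ultimately show "Monom ?w \<in> A \<inter> B" by blast
  show "restrict_monom Y ?w = restrict_monom Y a"
    by (simp add: restrict_monom_add restrict_monom_restrict)
qed

text \<open>Each monomial of an element of both images lifts to \<open>A \<inter> B\<close> by the previous lemma, and these
  lifts may be chosen one monomial at a time because \<open>K\<close>-linear combinations stay in the ideal
  \<open>A \<inter> B\<close>. Arbitrary ideals would not do: setting \<open>y\<close> to 1 sends both \<open>(x)\<close> and \<open>(x + y - 1)\<close> to
  \<open>(x)\<close>, but their intersection to \<open>(x\<^sup>2)\<close>.\<close>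

lemma monomial_loc_Int:
  fixes A B P :: "('x, 'k::field) mpoly set"
  assumes A: "ideal A (poly_ring X)" "has_monomials A"
    and B: "ideal B (poly_ring X)" "has_monomials B"
  shows "monomial_loc P (A \<inter> B) = monomial_loc P A \<inter> monomial_loc P B"
proof
  show "monomial_loc P (A \<inter> B) \<subseteq> monomial_loc P A \<inter> monomial_loc P B"
    by (auto simp: monomial_loc_def)
  interpret R: ring "poly_ring X :: ('x, 'k) mpoly ring" by (rule ring_poly_ring)
  interpret AB: ideal "A \<inter> B" "poly_ring X" by (rule R.i_intersect[OF A(1) B(1)])
  let ?Y = "vars_in P"
  show "monomial_loc P A \<inter> monomial_loc P B \<subseteq> monomial_loc P (A \<inter> B)"
  proof
    fix y assume "y \<in> monomial_loc P A \<inter> monomial_loc P B"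
    then obtain f g where f: "f \<in> A" "y = loc_hom P f" and g: "g \<in> B" "y = loc_hom P g"
      by (auto simp: monomial_loc_def)
    have "\<exists>w. (Monom w :: ('x, 'k) mpoly) \<in> A \<inter> B \<and> restrict_monom ?Y w = m"
      if m: "m \<in> Poly_Mapping.keys y" for m
    proof -
      obtain a where a: "a \<in> Poly_Mapping.keys f" "m = restrict_monom ?Y a"
        using m keys_loc_hom[of P f] f(2) by blast
      obtain b where b: "b \<in> Poly_Mapping.keys g" "m = restrict_monom ?Y b"
        using m keys_loc_hom[of P g] g(2) by blast
      have "restrict_monom ?Y a = restrict_monom ?Y b" using a(2) b(2) by simp
      from common_monomial_lift[OF A(1) B(1) has_monomialsD[OF A(2) f(1) a(1)]
          has_monomialsD[OF B(2) g(1) b(1)] this]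
      show ?thesis using a(2) by blast
    qed
    then obtain w where w: "\<And>m. m \<in> Poly_Mapping.keys y \<Longrightarrow>
        (Monom (w m) :: ('x, 'k) mpoly) \<in> A \<inter> B \<and> restrict_monom ?Y (w m) = m"
      by metis
    define z where
      "z = (\<Sum>m\<in>Poly_Mapping.keys y. Poly_Mapping.single (w m) (Poly_Mapping.lookup y m))"
    have term_in: "Poly_Mapping.single (w m) (Poly_Mapping.lookup y m) \<in> A \<inter> B"
      if "m \<in> Poly_Mapping.keys y" for m
      using AB.I_l_closed[OF conjunct1[OF w[OF that]] poly_ring_carrier_Const]
      by (simp add: Const_def Monom_def mult_single)
    have sum_in: "sum F C \<in> A \<inter> B" if "\<And>c. c \<in> C \<Longrightarrow> F c \<in> A \<inter> B"
      for F :: "('x \<Rightarrow>\<^sub>0 nat) \<Rightarrow> ('x, 'k) mpoly" and C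
      using that
    proof (induction C rule: infinite_finite_induct)
      case (insert c C)
      have "F c + sum F C \<in> A \<inter> B"
        using AB.a_closed[of "F c" "sum F C"] insert by simp
      then show ?case using insert.hyps by simp
    qed (use AB.zero_closed in simp_all)
    have "z \<in> A \<inter> B"
      unfolding z_def by (rule sum_in[OF term_in])
    moreover have "loc_hom P z = (\<Sum>m\<in>Poly_Mapping.keys y.
        loc_hom P (Poly_Mapping.single (w m) (Poly_Mapping.lookup y m)))"
      unfolding z_def loc_hom_def by (rule subst_sum)
    then have "loc_hom P z = y"
      by (simp add: loc_hom_single w mpoly_expand)
    ultimately show "y \<in> monomial_loc P (A \<inter> B)"
      by (auto simp: monomial_loc_def)
  qed
qed

lemma vars_in_subset:
  fixes P :: "('x, 'k::field) mpoly set"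
  assumes "P \<subseteq> carrier (poly_ring X)"
  shows "vars_in P \<subseteq> X"
proof
  fix i assume "i \<in> vars_in P"
  then have "Var i \<in> carrier (poly_ring X :: ('x, 'k) mpoly ring)"
    using assms by (auto simp: vars_in_def)
  then show "i \<in> X" by (simp only: poly_ring_carrier_Var)
qed

theorem proposition5p4:
  fixes n :: nat and I J \<pp> :: "(nat, 'k::field) mpoly set"
  assumes "monomial_ideal {1..n} I" and "monomial_ideal {1..n} J" and "J \<subseteq> I"
    and "\<pp> \<in> Vstar {1..n} I"
    and "demotion (poly_ring {1..n}) J I"
  shows "demotion (loc_ring \<pp>) (monomial_loc \<pp> J) (monomial_loc \<pp> I)"
proof -
  let ?R = "poly_ring {1..n} :: (nat, 'k) mpoly ring"
  have "ideal \<pp> ?R"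
    using assms(4) by (auto simp: Vstar_def monomial_prime_def primeideal_def)
  then have "vars_in \<pp> \<subseteq> {1..n}"
    by (intro vars_in_subset additive_subgroup.a_subset ideal.axioms(1))
  then have surj: "loc_hom \<pp> ` carrier ?R = carrier (loc_ring \<pp>)"
    by (rule loc_hom_image_carrier)
  interpret h: ring_hom_ring ?R "loc_ring \<pp>" "loc_hom \<pp>"
    by (rule ring_hom_ringI2)
      (simp_all only: loc_ring_def[of \<pp>] ring_poly_ring, simp add: loc_hom_ring_hom flip: loc_ring_def)
  have I: "ideal I ?R" and J: "ideal J ?R"
    and dem: "ideal_prod ?R (ideal_pow ?R I r) (ideal_pow ?R J s)
      = ideal_pow ?R I (r + s) \<inter> ideal_pow ?R J s" for r s
    using assms(5) by (auto simp: demotion_def)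
  have "ideal_prod (loc_ring \<pp>) (ideal_pow (loc_ring \<pp>) (monomial_loc \<pp> I) r)
          (ideal_pow (loc_ring \<pp>) (monomial_loc \<pp> J) s)
      = ideal_pow (loc_ring \<pp>) (monomial_loc \<pp> I) (r + s) \<inter> ideal_pow (loc_ring \<pp>) (monomial_loc \<pp> J) s"
    for r s
  proof -
    have "ideal_prod (loc_ring \<pp>) (ideal_pow (loc_ring \<pp>) (monomial_loc \<pp> I) r)
          (ideal_pow (loc_ring \<pp>) (monomial_loc \<pp> J) s)
        = monomial_loc \<pp> (ideal_prod ?R (ideal_pow ?R I r) (ideal_pow ?R J s))"
      by (simp only: monomial_loc_def h.img_ideal_prod h.img_ideal_pow[OF surj]
          h.R.ideal_ideal_pow I J)
    also have "\<dots> = monomial_loc \<pp> (ideal_pow ?R I (r + s)) \<inter> monomial_loc \<pp> (ideal_pow ?R J s)"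
      unfolding dem
      by (intro monomial_loc_Int[where X = "{1..n}"] h.R.ideal_ideal_pow I J has_monomials_ideal_pow
          has_monomials_monomial_ideal[OF assms(1)] has_monomials_monomial_ideal[OF assms(2)])
    finally show ?thesis
      by (simp only: monomial_loc_def h.img_ideal_pow[OF surj] I J)
  qed
  moreover have "monomial_loc \<pp> J \<subseteq> monomial_loc \<pp> I"
    using assms(3) by (auto simp: monomial_loc_def)
  ultimately show ?thesis
    unfolding demotion_def using h.img_ideal_of_surj[OF surj] I J by (simp add: monomial_loc_def)
qed

end
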